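(* For any non-negative integer $n$ we have $$C_{2n} = \frac{1}{2n+1} \sum_{k=0}^n 4^k \, (n-k+1) \, \binom{2n}{2k} \, C_{n-k}, \qquad C_{2n+1} = \frac{1}{n+1} \sum_{k=0}^n 4^k \, (n-k+1) \, \binom{2n+1}{2k+1} \, C_{n-k}.$$
   Context: $C_n=\frac{1}{n+1}\binom{2n}{n}$ ($n\ge 0$) denotes the $n$-th Catalan number. *)

theory Defs imports Complex_Main begin

definition catalan :: "nat \<Rightarrow> real" where
  "catalan n = 1 / (real n + 1) * real ((2 * n) choose n)"

end

theory Submission
  imports Defs "HOL-Computational_Algebra.Polynomial"
begin

text \<open>
  Since \<open>(m + 1) C\<^sub>m = binom(2m, m)\<close>, both identities say that
  \<open>binom(2N, N) = (\<Sum>j. 2^j binom(N, j) binom(N - j, (N - j) / 2))\<close>, the sum being over those \<open>j\<close>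
  with \<open>N - j\<close> even. This is the coefficient of \<open>x^N\<close> in
  \<open>(1 + x)^(2N) = (2x + (1 + x^2))^N\<close>; take \<open>N = 2n\<close> and \<open>N = 2n + 1\<close>.
\<close>

text \<open>Binomial expansion, with \<open>d\<close> general so as to serve both
  \<open>1 + x\<close> and \<open>1 + x^2\<close>. Keeping the sum over \<open>i\<close> avoids
  dividing \<open>k\<close> by \<open>d\<close>.\<close>

lemma coeff_one_plus_monom_power:
  "coeff ((1 + monom 1 d) ^ m :: 'a::comm_semiring_1 poly) k =
     (\<Sum>i\<le>m. if d * i = k then of_nat (m choose i) else 0)"
proof -
  have "(1 + monom 1 d :: 'a poly) ^ m = (monom 1 d + 1) ^ m"
    by (simp add: add.commute)
  also have "\<dots> = (\<Sum>i\<le>m. monom (of_nat (m choose i)) (d * i))"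
    unfolding binomial_ring
    by (simp add: monom_power of_nat_monom mult_monom mult.commute)
  finally show ?thesis
    by (simp add: coeff_sum)
qed

lemma coeff_one_plus_X_power:
  "coeff ((1 + monom 1 1) ^ m :: 'a::comm_semiring_1 poly) k = of_nat (m choose k)"
  by (simp only: coeff_one_plus_monom_power) (simp add: binomial_eq_0)

text \<open>Only the term with \<open>2 * i = m\<close> reaches degree \<open>m\<close>, and such an
  \<open>i\<close> exists exactly for even \<open>m\<close>.\<close>

lemma middle_coeff_one_plus_X_square_power:
  "coeff ((1 + monom 1 2) ^ m :: 'a::comm_semiring_1 poly) m =
     (if even m then of_nat (m choose (m div 2)) else 0)"
proof (cases "even m")
  case True
  then have "2 * i = m \<longleftrightarrow> i = m div 2" for i by auto
  then show ?thesis
    using True by (simp add: coeff_one_plus_monom_power)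
next
  case False
  then have "2 * i \<noteq> m" for i by auto
  then show ?thesis
    using False by (simp add: coeff_one_plus_monom_power)
qed

lemma central_binomial_eq_sum:
  "(2 * N) choose N =
     (\<Sum>j\<le>N. if even (N - j) then 2 ^ j * (N choose j) * ((N - j) choose ((N - j) div 2)) else 0)"
proof -
  have sq: "(1 + monom 1 1 :: nat poly)\<^sup>2 = monom 2 1 + (1 + monom 1 2)"
  proof -
    have "monom 2 1 = monom 1 1 + monom (1 :: nat) 1"
      by (simp add: add_monom)
    moreover have "monom 1 1 * monom 1 1 = monom (1 :: nat) 2"
      by (simp add: mult_monom numeral_2_eq_2)
    ultimately show ?thesis
      by (simp only: power2_eq_square algebra_simps mult_1_left mult_1_right)
  qed
  have "(2 * N) choose N = coeff ((1 + monom 1 1 :: nat poly) ^ (2 * N)) N"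
    by (simp only: coeff_one_plus_X_power of_nat_id)
  also have "\<dots> = coeff ((monom 2 1 + (1 + monom 1 2 :: nat poly)) ^ N) N"
    by (simp only: power_mult sq)
  also have "\<dots> = (\<Sum>j\<le>N. coeff (monom (2 ^ j * (N choose j)) j * (1 + monom 1 2) ^ (N - j)) N)"
    unfolding binomial_ring
    by (simp add: coeff_sum monom_power of_nat_monom mult_monom mult.commute)
  \<comment> \<open>The factor \<open>x^j\<close> shifts the index from \<open>N\<close> to
    \<open>N - j\<close>, which is the middle degree of the remaining power
    \<open>(1 + x^2)^(N - j)\<close>.\<close>
  also have "\<dots> = (\<Sum>j\<le>N. if even (N - j) then 2 ^ j * (N choose j) * ((N - j) choose ((N - j) div 2)) else 0)"
    by (intro sum.cong refl)
      (simp add: coeff_monom_mult middle_coeff_one_plus_X_square_power del: One_nat_def)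
  finally show ?thesis .
qed

text \<open>With \<open>N = 2 * n + r\<close>, the surviving indices \<open>j\<close> are those of
  the parity of \<open>r\<close>, so \<open>j = 2 * k + r\<close> and
  \<open>N - j = 2 * (n - k)\<close>. The parameter \<open>r\<close> treats even and odd
  \<open>N\<close> together.\<close>

lemma central_binomial_eq_sum_parity:
  assumes "r \<le> 1"
  shows "(2 * (2 * n + r)) choose (2 * n + r) =
    (\<Sum>k=0..n. 2 ^ (2 * k + r) * ((2 * n + r) choose (2 * k + r)) * ((2 * (n - k)) choose (n - k)))"
proof -
  let ?f = "\<lambda>j. 2 ^ j * ((2 * n + r) choose j) * ((2 * n + r - j) choose ((2 * n + r - j) div 2))"
  have "(2 * (2 * n + r)) choose (2 * n + r) = (\<Sum>j \<in> {j \<in> {..2 * n + r}. even (2 * n + r - j)}. ?f j)"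
    by (subst sum.inter_filter) (simp_all only: central_binomial_eq_sum finite_atMost)
  also have "\<dots> = (\<Sum>k=0..n. 2 ^ (2 * k + r) * ((2 * n + r) choose (2 * k + r)) * ((2 * (n - k)) choose (n - k)))"
  proof (rule sum.reindex_bij_witness[where i = "\<lambda>k. 2 * k + r" and j = "\<lambda>j. j div 2"])
    have r: "r = 0 \<or> r = 1" using assms by auto
    fix j assume "j \<in> {j \<in> {..2 * n + r}. even (2 * n + r - j)}"
    then have j: "j \<le> 2 * n + r" "even (2 * n + r - j)" by auto
    from j(2) obtain d where d: "2 * n + r - j = 2 * d" by (rule evenE)
    \<comment> \<open>Since \<open>j \<le> 2 * n + r\<close>, the subtraction is not truncated, so
      \<open>j\<close> and \<open>r\<close> have the same parity; as \<open>r \<le> 1\<close>,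
      \<open>r\<close> is the remainder of \<open>j\<close> modulo 2.\<close>
    show j': "2 * (j div 2) + r = j" using j d r by presburger
    show "j div 2 \<in> {0..n}" using j r by auto
    have "2 * n + r - j = 2 * (n - j div 2)" using j' by simp
    then show "2 ^ (2 * (j div 2) + r) * ((2 * n + r) choose (2 * (j div 2) + r))
        * ((2 * (n - j div 2)) choose (n - j div 2)) = ?f j"
      using j' by simp
  qed (use assms in auto)
  finally show ?thesis .
qed

lemma catalan_mult_Suc: "(real m + 1) * catalan m = real ((2 * m) choose m)"
  by (simp add: catalan_def)

lemma catalan_sum_parity:
  assumes "r \<le> 1"
  shows "(real (2 * n + r) + 1) * catalan (2 * n + r) = 2 ^ r *
    (\<Sum>k=0..n. 4 ^ k * (real n - real k + 1) * real ((2 * n + r) choose (2 * k + r)) * catalan (n - k))"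
proof -
  have "(real (2 * n + r) + 1) * catalan (2 * n + r) =
    (\<Sum>k=0..n. 2 ^ (2 * k + r) * real ((2 * n + r) choose (2 * k + r)) * real ((2 * (n - k)) choose (n - k)))"
    unfolding catalan_mult_Suc central_binomial_eq_sum_parity[OF assms] by simp
  \<comment> \<open>Here \<open>2 ^ (2 * k + r) = 2 ^ r * 4 ^ k\<close>, and the central binomial
    coefficient of \<open>n - k\<close> supplies the factor \<open>n - k + 1\<close> along with
    \<open>catalan (n - k)\<close>.\<close>
  also have "\<dots> = (\<Sum>k=0..n. 2 ^ r * (4 ^ k * (real n - real k + 1)
      * real ((2 * n + r) choose (2 * k + r)) * catalan (n - k)))"
    by (intro sum.cong refl, unfold catalan_mult_Suc[symmetric])
      (simp add: of_nat_diff power_add power_mult)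
  finally show ?thesis by (simp only: sum_distrib_left)
qed

theorem proposition6p1:
  fixes n :: nat
  shows "catalan (2 * n) =
           1 / (2 * real n + 1) *
             (\<Sum>k=0..n. 4 ^ k * (real n - real k + 1) * real ((2 * n) choose (2 * k)) * catalan (n - k))
       \<and> catalan (2 * n + 1) =
           1 / (real n + 1) *
             (\<Sum>k=0..n. 4 ^ k * (real n - real k + 1) * real ((2 * n + 1) choose (2 * k + 1)) * catalan (n - k))"
    (is "_ = _ * ?even \<and> _ = _ * ?odd")
proof
  have "(2 * real n + 1) * catalan (2 * n) = ?even"
    using catalan_sum_parity[of 0 n] by simp
  then show "catalan (2 * n) = 1 / (2 * real n + 1) * ?even"
    by (simp add: field_simps)
  have "(real (2 * n + 1) + 1) * catalan (2 * n + 1) = 2 * ?odd"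
    using catalan_sum_parity[of 1 n] by (simp only: le_refl power_one_right)
  \<comment> \<open>The left factor is \<open>2 * n + 2\<close>, so the 2 coming from
    \<open>2 ^ r\<close> cancels.\<close>
  then have "(real n + 1) * catalan (2 * n + 1) = ?odd"
    by (simp add: algebra_simps)
  then show "catalan (2 * n + 1) = 1 / (real n + 1) * ?odd"
    by (simp add: field_simps)
qed

end
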